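(* Let $n\ge1$, let $(\mathcal{C},\varphi)$ be a noncommutative probability space and $x\in\mathcal{C}$ a circular random variable. Let $D\in M_n(\mathbb{C})$ be a diagonal matrix with diagonal entries $D_1,\ldots,D_n$, and let $P\in M_n(\mathbb{C})$ be a permutation matrix, with associated permutation $\pi$ of $\{1,\ldots,n\}$, i.e. $P_{k,l}=1$ if $l=\pi(k)$ and $P_{k,l}=0$ otherwise. Put $M:=DP$ and $$\widehat{Mx}:=\begin{pmatrix}0&Mx\\ M^*x^*&0\end{pmatrix}\in M_{2n}(\mathcal{C}).$$ Then, for $J=\begin{pmatrix}J_1&0\\0&J_2\end{pmatrix}$ in $\mathcal{H}^+(M_{2n}(\mathbb{C}))$ with $J_1,J_2$ diagonal matrices in $M_n(\mathbb{C})$ with diagonal entries $[J_1]_k,[J_2]_k$ ($1\le k\le n$), $$G_{\widehat{Mx}}(J)=\mathrm{diag}\Big([J_2]_{\pi(1)}|D_1|^{-2}G_{xx^*}\big([J_1]_1[J_2]_{\pi(1)}|D_1|^{-2}\big),\ \ldots,\ [J_1]_{\pi^{-1}(n)}|D_{\pi^{-1}(n)}|^{-2}G_{x^*x}\big([J_1]_{\pi^{-1}(n)}[J_2]_n|D_{\pi^{-1}(n)}|^{-2}\big)\Big).$$ That is, $G_{\widehat{Mx}}(J)$ is the diagonal matrix in $M_{2n}(\mathbb{C})$ whose $k$-th diagonal entry, for $1\le k\le n$, is $$[J_2]_{\pi(k)}\,|D_k|^{-2}\,G_{xx^*}\big([J_1]_k[J_2]_{\pi(k)}|D_k|^{-2}\big),$$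 and whose $(n+k)$-th diagonal entry, for $1\le k\le n$, is $$[J_1]_{\pi^{-1}(k)}\,|D_{\pi^{-1}(k)}|^{-2}\,G_{x^*x}\big([J_1]_{\pi^{-1}(k)}[J_2]_k|D_{\pi^{-1}(k)}|^{-2}\big).$$
   Context: A noncommutative probability space $(\mathcal{C},\varphi)$ here is a unital $C^*$-algebra $\mathcal{C}$ with a positive linear functional $\varphi:\mathcal{C}\to\mathbb{C}$ with $\varphi(\mathbf{1}_{\mathcal{C}})=1$. A circular random variable is an element of the form $x=(s_1+\mathrm{i}s_2)/\sqrt2$ with $s_1,s_2$ free selfadjoint centered semicircular elements of the same variance. For an integer $m\ge1$, $E:M_m(\mathcal{C})\to M_m(\mathbb{C})$ is the map applying $\varphi$ entrywise, and complex matrices are viewed in $M_m(\mathcal{C})$ via $\mathbb{C}\mathbf{1}_{\mathcal{C}}\subset\mathcal{C}$; $Mx$ denotes the matrix with entries $M_{k,l}x$, and $M^*x^*$ the matrix with entries $(M^* )_{k,l}x^*$. $\mathcal{H}^+(M_m(\mathbb{C}))$ is the set of $B\in M_m(\mathbb{C})$ such that $\Im(B)=\frac{B-B^*}{2\mathrm{i}}$ is positive definite. For selfadjoint $\mathbf{X}\in M_m(\mathcal{C})$, its $M_m(\mathbb{C})$-valued Cauchy transform is $G_{\mathbf{X}}(B)=E\big((B-\mathbf{X})^{-1}\big)$ for $B\in\mathcal{H}^+(M_m(\mathbb{C}))$. For $a\in\{xx^*,x^*x\}$, $G_a(\zeta)=\varphi\big((\zeta\mathbf{1}_{\mathcal{C}}-a)^{-1}\big)$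 for $\zeta\in\mathbb{C}\setminus[0,\infty)$ is its scalar Cauchy transform.
   Formalization: Since |D_k|^{-2} is undefined when D_k = 0, each diagonal-entry formula is asserted only when the entry of D occurring in it is nonzero; that the Cauchy transform is diagonal is asserted for every diagonal D. *)

theory Defs
  imports "HOL-Analysis.Analysis"
begin

text \<open>
  Unital \<open>C\<^sup>*\<close>-algebras. The class \<^class>\<open>real_normed_algebra_1\<close> includes
  \<open>norm 1 = 1\<close>, hence \<open>1 \<noteq> 0\<close>. This loses nothing here: a functional with \<open>\<phi> 1 = 1\<close> excludes
  the zero algebra, and in a nonzero unital \<open>C\<^sup>*\<close>-algebra \<open>norm 1 = 1\<close> is automatic.
\<close>

class cstar_algebra = real_normed_algebra_1 + banach +
  fixes scaleC :: "complex \<Rightarrow> 'a \<Rightarrow> 'a"  (infixr \<open>*\<^sub>C\<close> 75)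
    and adj :: "'a \<Rightarrow> 'a"
  assumes scaleR_scaleC: "r *\<^sub>R a = complex_of_real r *\<^sub>C a"
    and scaleC_add_right: "c *\<^sub>C (a + b) = c *\<^sub>C a + c *\<^sub>C b"
    and scaleC_add_left: "(c + d) *\<^sub>C a = c *\<^sub>C a + d *\<^sub>C a"
    and scaleC_scaleC: "c *\<^sub>C d *\<^sub>C a = (c * d) *\<^sub>C a"
    and mult_scaleC_left: "(c *\<^sub>C a) * b = c *\<^sub>C (a * b)"
    and mult_scaleC_right: "a * (c *\<^sub>C b) = c *\<^sub>C (a * b)"
    and norm_scaleC: "norm (c *\<^sub>C a) = cmod c * norm a"
    and adj_adj: "adj (adj a) = a"
    and adj_add: "adj (a + b) = adj a + adj b"
    and adj_scaleC: "adj (c *\<^sub>C a) = cnj c *\<^sub>C adj a"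
    and adj_mult: "adj (a * b) = adj b * adj a"
    and cstar_identity: "norm (adj a * a) = (norm a)\<^sup>2"

text \<open>
  The inverse in a ring; as for \<^const>\<open>matrix_inv\<close>, the value is unspecified for
  non-invertible elements.
\<close>

definition alg_inv :: "'a::ring_1 \<Rightarrow> 'a" where
  "alg_inv a = (SOME b. a * b = 1 \<and> b * a = 1)"

definition nc_state :: "('a::cstar_algebra \<Rightarrow> complex) \<Rightarrow> bool" where
  "nc_state \<phi> \<longleftrightarrow>
     (\<forall>a b. \<phi> (a + b) = \<phi> a + \<phi> b) \<and>
     (\<forall>c a. \<phi> (c *\<^sub>C a) = c * \<phi> a) \<and>
     (\<forall>a. \<phi> (adj a * a) \<in> \<real>\<^sub>\<ge>\<^sub>0) \<and>
     \<phi> 1 = 1"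

inductive_set unital_subalg :: "'a::cstar_algebra set \<Rightarrow> 'a set" for S where
  base: "a \<in> S \<Longrightarrow> a \<in> unital_subalg S"
| one: "1 \<in> unital_subalg S"
| scale: "a \<in> unital_subalg S \<Longrightarrow> c *\<^sub>C a \<in> unital_subalg S"
| add: "a \<in> unital_subalg S \<Longrightarrow> b \<in> unital_subalg S \<Longrightarrow> a + b \<in> unital_subalg S"
| mult: "a \<in> unital_subalg S \<Longrightarrow> b \<in> unital_subalg S \<Longrightarrow> a * b \<in> unital_subalg S"

text \<open>
  Freeness of a family of subalgebras: a product of centered elements whose neighbouring
  factors come from different members of the family is centered.
\<close>

definition free_family :: "('a::cstar_algebra \<Rightarrow> complex) \<Rightarrow> ('i \<Rightarrow> 'a set) \<Rightarrow> bool" where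
  "free_family \<phi> A \<longleftrightarrow>
     (\<forall>xs :: ('i \<times> 'a) list.
        xs \<noteq> [] \<longrightarrow> distinct_adj (map fst xs) \<longrightarrow>
        (\<forall>(i, a) \<in> set xs. a \<in> A i \<and> \<phi> a = 0) \<longrightarrow>
        \<phi> (prod_list (map snd xs)) = 0)"

text \<open>
  Intended for selfadjoint elements, where the unital algebra generated by one of them is
  already closed under \<^const>\<open>adj\<close>.
\<close>

definition free_pair :: "('a::cstar_algebra \<Rightarrow> complex) \<Rightarrow> 'a \<Rightarrow> 'a \<Rightarrow> bool" where
  "free_pair \<phi> s t \<longleftrightarrow> free_family \<phi> (\<lambda>i::bool. unital_subalg {if i then s else t})"

text \<open>
  The distribution of a selfadjoint element with respect to \<open>\<phi>\<close> is the compactly supported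
  measure with moments \<open>\<phi> (s ^ k)\<close>; here it is the centered semicircle law of
  variance \<open>\<sigma>\<^sup>2 > 0\<close>.
\<close>

definition semicircular :: "('a::cstar_algebra \<Rightarrow> complex) \<Rightarrow> real \<Rightarrow> 'a \<Rightarrow> bool" where
  "semicircular \<phi> \<sigma> s \<longleftrightarrow>
     \<sigma> > 0 \<and> adj s = s \<and>
     (\<forall>k::nat. \<phi> (s ^ k) =
        complex_of_real (integral {- 2 * \<sigma>..2 * \<sigma>}
          (\<lambda>t. t ^ k * (sqrt (4 * \<sigma>\<^sup>2 - t\<^sup>2) / (2 * pi * \<sigma>\<^sup>2)))))"

definition circular :: "('a::cstar_algebra \<Rightarrow> complex) \<Rightarrow> 'a \<Rightarrow> bool" where
  "circular \<phi> x \<longleftrightarrow>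
     (\<exists>s1 s2 \<sigma>. semicircular \<phi> \<sigma> s1 \<and> semicircular \<phi> \<sigma> s2 \<and> free_pair \<phi> s1 s2 \<and>
        x = complex_of_real (1 / sqrt 2) *\<^sub>C (s1 + \<i> *\<^sub>C s2))"

text \<open>The scalar Cauchy transform, meant for \<open>\<zeta>\<close> outside the spectrum of \<open>a\<close>.\<close>

definition cauchy_transform :: "('a::cstar_algebra \<Rightarrow> complex) \<Rightarrow> 'a \<Rightarrow> complex \<Rightarrow> complex" where
  "cauchy_transform \<phi> a \<zeta> = \<phi> (alg_inv (\<zeta> *\<^sub>C 1 - a))"

definition diag_mat :: "'a::zero ^ 'n \<Rightarrow> 'a ^ 'n ^ 'n" where
  "diag_mat v = (\<chi> k l. if k = l then v $ k else 0)"

definition perm_mat :: "('n \<Rightarrow> 'n) \<Rightarrow> complex ^ 'n ^ 'n" where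
  "perm_mat \<pi> = (\<chi> k l. if l = \<pi> k then 1 else 0)"

definition conj_transpose :: "complex ^ 'n ^ 'n \<Rightarrow> complex ^ 'n ^ 'n" where
  "conj_transpose B = (\<chi> k l. cnj (B $ l $ k))"

text \<open>
  A \<open>2n \<times> 2n\<close> matrix is indexed by \<open>'n + 'n\<close>: the index \<open>Inl k\<close> stands for \<open>k\<close> and \<open>Inr k\<close>
  for \<open>n + k\<close>.
\<close>

definition block_mat ::
  "'a ^ 'n ^ 'n \<Rightarrow> 'a ^ 'n ^ 'n \<Rightarrow> 'a ^ 'n ^ 'n \<Rightarrow> 'a ^ 'n ^ 'n \<Rightarrow> 'a ^ ('n + 'n) ^ ('n + 'n)" where
  "block_mat A B C D = (\<chi> i j.
     case i of
       Inl k \<Rightarrow> (case j of Inl l \<Rightarrow> A $ k $ l | Inr l \<Rightarrow> B $ k $ l)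
     | Inr k \<Rightarrow> (case j of Inl l \<Rightarrow> C $ k $ l | Inr l \<Rightarrow> D $ k $ l))"

definition mat_Im :: "complex ^ 'm ^ 'm \<Rightarrow> complex ^ 'm ^ 'm" where
  "mat_Im B = (\<chi> k l. (B - conj_transpose B) $ k $ l / (2 * \<i>))"

definition pos_definite :: "complex ^ 'm ^ 'm \<Rightarrow> bool" where
  "pos_definite H \<longleftrightarrow>
     conj_transpose H = H \<and>
     (\<forall>v. v \<noteq> 0 \<longrightarrow> 0 < Re (\<Sum>k\<in>UNIV. cnj (v $ k) * (H *v v) $ k))"

definition upper_half :: "(complex ^ 'm ^ 'm) set" where
  "upper_half = {B. pos_definite (mat_Im B)}"

definition mat_embed :: "complex ^ 'm ^ 'm \<Rightarrow> 'a::cstar_algebra ^ 'm ^ 'm" where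
  "mat_embed B = (\<chi> k l. (B $ k $ l) *\<^sub>C 1)"

definition mat_scale :: "complex ^ 'm ^ 'm \<Rightarrow> 'a::cstar_algebra \<Rightarrow> 'a ^ 'm ^ 'm" where
  "mat_scale B a = (\<chi> k l. (B $ k $ l) *\<^sub>C a)"

definition mat_expect ::
  "('a::cstar_algebra \<Rightarrow> complex) \<Rightarrow> 'a ^ 'm ^ 'm \<Rightarrow> complex ^ 'm ^ 'm" where
  "mat_expect \<phi> X = (\<chi> k l. \<phi> (X $ k $ l))"

text \<open>
  The matrix-valued Cauchy transform, meant for selfadjoint \<open>X\<close> and \<open>B \<in> upper_half\<close>, where
  \<open>mat_embed B - X\<close> is invertible.
\<close>

definition mat_cauchy_transform ::
  "('a::cstar_algebra \<Rightarrow> complex) \<Rightarrow> 'a ^ 'm ^ 'm \<Rightarrow> complex ^ 'm ^ 'm \<Rightarrow> complex ^ 'm ^ 'm" where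
  "mat_cauchy_transform \<phi> X B = mat_expect \<phi> (matrix_inv (mat_embed B - X))"

definition mat_hat :: "complex ^ 'n ^ 'n \<Rightarrow> 'a::cstar_algebra \<Rightarrow> 'a ^ ('n + 'n) ^ ('n + 'n)" where
  "mat_hat M x = block_mat 0 (mat_scale M x) (mat_scale (conj_transpose M) (adj x)) 0"

end

theory Submission
  imports Defs
begin

text \<open>
  Up to the permutation, \<open>J - X\<close> splits into \<open>2 \<times> 2\<close> blocks \<open>(p, - y; - adj y, q)\<close> with \<open>y = D\<^sub>k x\<close>,
  whose inverse is explicit in terms of the resolvents of \<open>y * adj y\<close> and \<open>adj y * y\<close> at
  \<open>p q \<notin> [0, \<infinity>)\<close>. These exist because \<open>adj y * y\<close> is positive (Kaplansky), which puts its
  spectrum into a disc that excludes \<open>p q\<close>, so that the resolvent is a geometric series in a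
  polynomial of \<open>adj y * y\<close>. The off-diagonal entries \<open>y (p q - adj y * y)\<inverse>\<close> then are limits of
  polynomials in the two semicirculars of odd total degree, and freeness kills the state on these:
  such a polynomial is a combination of alternating products of centered powers of odd total degree.

  Positivity is defined by \<open>norm (t - a) \<le> t\<close> instead of through the spectrum, and square roots come
  from the binomial series, so no functional calculus is needed.
\<close>

subsection \<open>Elementary facts on \<open>C\<^sup>*\<close>-algebras\<close>

lemma scaleC_one [simp]: "1 *\<^sub>C (a::'a::cstar_algebra) = a"
  using scaleR_scaleC[of 1 a] by simp

lemma scaleC_zero_left [simp]: "0 *\<^sub>C (a::'a::cstar_algebra) = 0"
  using scaleR_scaleC[of 0 a] by simp

lemma scaleC_zero_right [simp]: "c *\<^sub>C (0::'a::cstar_algebra) = 0"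
  using scaleC_add_right[of c 0 "0::'a"] by simp

lemma scaleC_minus_left: "(- c) *\<^sub>C (a::'a::cstar_algebra) = - (c *\<^sub>C a)"
  using scaleC_add_left[of "-c" c a] by (simp add: eq_neg_iff_add_eq_0)

lemma scaleC_minus_right: "c *\<^sub>C (- a::'a::cstar_algebra) = - (c *\<^sub>C a)"
  using scaleC_add_right[of c "-a" a] by (simp add: eq_neg_iff_add_eq_0)

lemma scaleC_diff_left: "(c - d) *\<^sub>C (a::'a::cstar_algebra) = c *\<^sub>C a - d *\<^sub>C a"
  using scaleC_add_left[of c "-d" a] by (simp add: scaleC_minus_left)

lemma scaleC_diff_right: "c *\<^sub>C (a - b::'a::cstar_algebra) = c *\<^sub>C a - c *\<^sub>C b"
  using scaleC_add_right[of c a "-b"] by (simp add: scaleC_minus_right)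

lemma scaleC_scaleR: "c *\<^sub>C r *\<^sub>R (a::'a::cstar_algebra) = r *\<^sub>R c *\<^sub>C a"
  by (simp add: scaleR_scaleC scaleC_scaleC mult.commute)

lemmas scaleC_simps = scaleC_add_right scaleC_add_left scaleC_diff_left scaleC_diff_right
  scaleC_scaleC mult_scaleC_left mult_scaleC_right scaleC_minus_left scaleC_minus_right

lemma adj_one [simp]: "adj (1::'a::cstar_algebra) = 1"
  by (metis adj_adj adj_mult mult.right_neutral mult_1)

lemma adj_scaleR: "adj (r *\<^sub>R a) = r *\<^sub>R adj (a::'a::cstar_algebra)"
  by (simp add: scaleR_scaleC adj_scaleC)

lemma adj_minus: "adj (- a) = - adj (a::'a::cstar_algebra)"
  using adj_scaleR[of "-1" a] by simp

lemma adj_diff: "adj (a - b) = adj a - adj (b::'a::cstar_algebra)"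
  using adj_add[of a "-b"] by (simp add: adj_minus)

text \<open>The identity \<open>norm (adj b * b) = (norm b)\<^sup>2\<close> with submultiplicativity
  gives one inequality; the other is the same for \<open>adj b\<close>.\<close>

lemma norm_adj [simp]: "norm (adj a) = norm (a::'a::cstar_algebra)"
proof -
  have le: "norm b \<le> norm (adj b)" for b :: 'a
  proof (cases "b = 0")
    case False
    have "norm b * norm b \<le> norm (adj b) * norm b"
      using cstar_identity[of b] norm_mult_ineq[of "adj b" b] by (simp add: power2_eq_square)
    then show ?thesis using False by simp
  qed simp
  show ?thesis using le[of a] le[of "adj a"] by (simp add: adj_adj)
qed

lemma bounded_linear_adj: "bounded_linear (adj :: 'a::cstar_algebra \<Rightarrow> 'a)"
  by (rule bounded_linear_intro[where K=1]) (auto simp: adj_add adj_scaleR)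

lemma norm_square_selfadjoint:
  fixes a :: "'a::cstar_algebra"
  assumes "adj a = a"
  shows "norm (a * a) = (norm a)\<^sup>2"
  using cstar_identity[of a] assms by simp

lemma adj_power: "adj (a ^ n) = adj (a::'a::cstar_algebra) ^ n"
  by (induction n) (auto simp: adj_mult power_commutes)

text \<open>Stands in for the spectral radius formula: a growth bound on the powers of a selfadjoint
  element bounds its norm.\<close>

lemma norm_power_two_power_selfadjoint:
  fixes a :: "'a::cstar_algebra"
  assumes "adj a = a"
  shows "norm (a ^ (2 ^ m)) = norm a ^ (2 ^ m)"
proof (induction m)
  case (Suc m)
  have "norm (a ^ 2 ^ Suc m) = norm (a ^ 2 ^ m * a ^ 2 ^ m)"
    by (simp add: power_add[symmetric] mult_2)
  also have "\<dots> = (norm (a ^ 2 ^ m))\<^sup>2"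
    by (rule norm_square_selfadjoint) (simp add: adj_power assms)
  finally show ?case by (simp add: Suc power_mult[symmetric] mult.commute)
qed simp

subsection \<open>The binomial series of the square root\<close>

text \<open>The Taylor coefficients of \<open>sqrt (1 - t)\<close> at 0.\<close>

definition sqrt_coeff :: "nat \<Rightarrow> real" where
  "sqrt_coeff n = (1/2 gchoose n) * (-1) ^ n"

lemma sqrt_coeff_0 [simp]: "sqrt_coeff 0 = 1"
  by (simp add: sqrt_coeff_def)

lemma sqrt_coeff_Suc_nonpos: "sqrt_coeff (Suc n) \<le> 0"
proof -
  have "sqrt_coeff (Suc n) = pochhammer (- (1/2)) (Suc n) / fact (Suc n)"
    by (simp add: sqrt_coeff_def gbinomial_pochhammer power_mult_distrib[symmetric] del: power_Suc fact_Suc)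
  also have "\<dots> = - (1/2) * pochhammer (1/2) n / fact (Suc n)"
    by (simp add: pochhammer_rec del: fact_Suc)
  also have "\<dots> \<le> 0"
    using pochhammer_pos[of "1/2::real" n]
    by (intro divide_nonpos_pos mult_nonpos_nonneg) auto
  finally show ?thesis .
qed

text \<open>The partial sums of all coefficients are \<open>pochhammer (1/2) n / fact n\<close>,
  hence nonnegative; the constant term is 1 and the others are nonpositive. This yields absolute
  convergence on the closed unit ball, boundary included.\<close>

lemma sum_abs_sqrt_coeff_le: "(\<Sum>k<n. \<bar>sqrt_coeff (Suc k)\<bar>) \<le> 1"
proof -
  have "(\<Sum>k\<le>n. sqrt_coeff k) = (-1) ^ n * (- (1/2) gchoose n)"
    unfolding sqrt_coeff_def by (subst gbinomial_sum_lower_neg) simp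
  also have "\<dots> = pochhammer (1/2) n / fact n"
    by (simp add: gbinomial_pochhammer power_mult_distrib[symmetric])
  also have "\<dots> \<ge> 0"
    using pochhammer_pos[of "1/2::real" n] by (intro divide_nonneg_pos) auto
  finally have "0 \<le> (\<Sum>k\<le>n. sqrt_coeff k)" .
  moreover have "(\<Sum>k\<le>n. sqrt_coeff k) = 1 + (\<Sum>k<n. sqrt_coeff (Suc k))"
    by (simp add: sum.atMost_shift)
  ultimately show ?thesis
    using sqrt_coeff_Suc_nonpos by (simp add: sum_negf abs_of_nonpos)
qed

lemma summable_abs_sqrt_coeff: "summable (\<lambda>k. \<bar>sqrt_coeff (Suc k)\<bar>)"
  by (rule summableI_nonneg_bounded[where x=1]) (auto simp: sum_abs_sqrt_coeff_le)

text \<open>Vandermonde's identity: the square of the series is \<open>1 - t\<close>.\<close>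

lemma sqrt_coeff_convolution:
  "(\<Sum>i\<le>n. sqrt_coeff i * sqrt_coeff (n - i)) = (if n = 0 then 1 else if n = 1 then -1 else 0)"
proof -
  have "(\<Sum>i\<le>n. sqrt_coeff i * sqrt_coeff (n - i))
      = (\<Sum>i\<le>n. (-1) ^ n * ((1/2 gchoose i) * (1/2 gchoose (n - i))))"
    by (rule sum.cong) (auto simp: sqrt_coeff_def power_add[symmetric] algebra_simps)
  also have "\<dots> = (-1) ^ n * (1 gchoose n)"
    using gbinomial_Vandermonde[of "1/2::real" "1/2" n]
    by (simp add: sum_distrib_left[symmetric] atLeast0AtMost)
  also have "(1::real) gchoose n = of_nat (1 choose n)"
    by (metis binomial_gbinomial of_nat_1)
  finally show ?thesis
    by (cases n) (auto simp: binomial_eq_0)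
qed

lemma exists_sqrt_unit_ball:
  fixes w :: "'a::cstar_algebra"
  assumes w: "norm w \<le> 1" and sa: "adj w = w"
  obtains b where "adj b = b" "b * b = 1 - w" "norm (1 - b) \<le> 1"
    "\<And>z. z * w = w * z \<Longrightarrow> z * b = b * z"
proof -
  define f where "f n = sqrt_coeff n *\<^sub>R w ^ n" for n
  define b where "b = (\<Sum>n. f n)"
  have nf: "norm (f n) \<le> \<bar>sqrt_coeff n\<bar>" for n
    using norm_power_ineq[of w n] power_le_one[of "norm w" n] w
    by (auto simp: f_def intro!: mult_left_le)
  have sumS: "summable (\<lambda>n. norm (f (Suc n)))"
    by (rule summable_comparison_test'[OF summable_abs_sqrt_coeff, of 0]) (use nf in auto)
  then have sumN: "summable (\<lambda>n. norm (f n))"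
    using summable_Suc_iff[of "\<lambda>n. norm (f n)"] by simp
  then have sumf: "summable f" by (rule summable_norm_cancel)
  have sa_b: "adj b = b"
  proof -
    have "adj b = (\<Sum>n. adj (f n))"
      unfolding b_def by (rule bounded_linear.suminf[OF bounded_linear_adj sumf])
    then show ?thesis by (simp add: b_def f_def adj_scaleR adj_power sa)
  qed
  have "(\<lambda>k. \<Sum>i\<le>k. f i * f (k - i)) sums (b * b)"
    unfolding b_def by (rule Cauchy_product_sums[OF sumN sumN])
  moreover have "(\<Sum>i\<le>k. f i * f (k - i)) = (if k = 0 then 1 else if k = 1 then - w else 0)" for k
  proof -
    have "(\<Sum>i\<le>k. f i * f (k - i)) = (\<Sum>i\<le>k. sqrt_coeff i * sqrt_coeff (k - i)) *\<^sub>R w ^ k"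
      unfolding scaleR_sum_left
      by (rule sum.cong) (auto simp: f_def power_add[symmetric])
    then show ?thesis by (auto simp: sqrt_coeff_convolution)
  qed
  ultimately have "(\<lambda>k. if k = 0 then 1 else if k = 1 then - w else 0) sums (b * b)"
    by simp
  moreover have "(\<lambda>k. if k = 0 then 1 else if k = 1 then - w else 0)
      sums (\<Sum>k\<in>{0,1::nat}. if k = 0 then 1 else if k = 1 then - w else 0)"
    by (rule sums_finite) auto
  ultimately have sq: "b * b = 1 - w"
    by (auto dest: sums_unique2)
  \<comment> \<open>Without its constant term 1 the series has coefficients of absolute sum at most
    1. This bound is what makes the root positive.\<close>
  have "norm (1 - b) \<le> 1"
  proof -
    have "b = (\<Sum>n. f (Suc n)) + 1"
      using suminf_split_head[OF sumf] by (simp add: b_def) (simp add: f_def)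
    then have "norm (1 - b) = norm (\<Sum>n. f (Suc n))" by simp
    also have "\<dots> \<le> (\<Sum>n. norm (f (Suc n)))" by (rule summable_norm[OF sumS])
    also have "\<dots> \<le> 1"
      by (rule suminf_le_const[OF sumS])
        (use nf sum_abs_sqrt_coeff_le order_trans sum_mono in meson)
    finally show ?thesis .
  qed
  moreover have "z * b = b * z" if "z * w = w * z" for z
  proof -
    have "z * w ^ n = w ^ n * z" for n
      using power_commuting_commutes[of w z n] that by simp
    then have "z * f n = f n * z" for n by (simp add: f_def)
    then show ?thesis
      by (simp add: b_def suminf_mult[OF sumf, symmetric] suminf_mult2[OF sumf])
  qed
  ultimately show ?thesis using that sa_b sq by blast
qed

subsection \<open>The positive cone\<close>

text \<open>For selfadjoint \<open>a\<close> the norm condition says that the spectrum lies in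
  \<open>[0, 2 t]\<close>.\<close>

definition positive :: "'a::cstar_algebra \<Rightarrow> bool" where
  "positive a \<longleftrightarrow> adj a = a \<and> (\<exists>t\<ge>0. norm (t *\<^sub>R 1 - a) \<le> t)"

lemma positive_add: "positive a \<Longrightarrow> positive b \<Longrightarrow> positive (a + b)"
proof -
  assume a: "positive a" and b: "positive b"
  then obtain s t where "s \<ge> 0" "norm (s *\<^sub>R 1 - a) \<le> s" "t \<ge> 0" "norm (t *\<^sub>R 1 - b) \<le> t"
    by (auto simp: positive_def)
  moreover have "(s + t) *\<^sub>R 1 - (a + b) = (s *\<^sub>R 1 - a) + (t *\<^sub>R 1 - b)"
    by (simp add: algebra_simps)
  ultimately have "norm ((s + t) *\<^sub>R 1 - (a + b)) \<le> s + t" "s + t \<ge> 0"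
    by (metis norm_triangle_mono, simp)
  then show "positive (a + b)" using a b by (auto simp: positive_def adj_add)
qed

lemma positive_scaleR: "positive a \<Longrightarrow> r \<ge> 0 \<Longrightarrow> positive (r *\<^sub>R a)"
proof -
  assume a: "positive a" and r: "r \<ge> 0"
  then obtain t where t: "t \<ge> 0" "norm (t *\<^sub>R 1 - a) \<le> t" by (auto simp: positive_def)
  have "(r * t) *\<^sub>R 1 - r *\<^sub>R a = r *\<^sub>R (t *\<^sub>R 1 - a)" by (simp add: algebra_simps)
  then have "norm ((r * t) *\<^sub>R 1 - r *\<^sub>R a) \<le> r * t" using t r by (simp add: mult_left_mono)
  then show "positive (r *\<^sub>R a)"
    using a t r by (auto simp: positive_def adj_scaleR intro!: exI[of _ "r * t"])
qed

text \<open>The witness \<open>t\<close> in \<open>positive\<close> may be enlarged, in particular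
  made nonzero so that one can divide by it.\<close>

lemma norm_diff_le_mono:
  fixes a :: "'a::cstar_algebra"
  assumes "norm (s *\<^sub>R 1 - a) \<le> s" "s \<le> t"
  shows "norm (t *\<^sub>R 1 - a) \<le> t"
proof -
  have "t *\<^sub>R 1 - a = (s *\<^sub>R 1 - a) + (t - s) *\<^sub>R 1" by (simp add: algebra_simps)
  then have "norm (t *\<^sub>R 1 - a) \<le> norm (s *\<^sub>R 1 - a) + norm ((t - s) *\<^sub>R (1::'a))"
    by (metis norm_triangle_ineq)
  then show ?thesis using assms by simp
qed

lemma positive_bound:
  fixes a :: "'a::cstar_algebra"
  assumes "positive a"
  obtains t where "t > 0" "norm (t *\<^sub>R 1 - a) \<le> t"
proof -
  obtain s where s: "s \<ge> 0" "norm (s *\<^sub>R 1 - a) \<le> s"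
    using assms by (auto simp: positive_def)
  show ?thesis
  proof (rule that)
    show "s + 1 > 0" using s by simp
    show "norm ((s + 1) *\<^sub>R 1 - a) \<le> s + 1"
      by (rule norm_diff_le_mono[OF s(2)]) simp
  qed
qed

text \<open>Rescaling writes \<open>p\<close> as \<open>t\<close> times \<open>1 - w\<close> with
  \<open>norm w \<le> 1\<close>. The last clause lets roots of commuting elements be shown to
  commute.\<close>

lemma positive_sqrt:
  fixes p :: "'a::cstar_algebra"
  assumes "positive p"
  obtains k where "positive k" "k * k = p" "\<And>z. z * p = p * z \<Longrightarrow> z * k = k * z"
proof -
  have sa: "adj p = p" using assms by (simp add: positive_def)
  obtain t where t: "t > 0" "norm (t *\<^sub>R 1 - p) \<le> t"
    using positive_bound[OF assms] .
  define w where "w = 1 - (1/t) *\<^sub>R p"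
  have tw: "t *\<^sub>R w = t *\<^sub>R 1 - p" using t by (simp add: w_def algebra_simps)
  have "norm (t *\<^sub>R w) \<le> t" using t tw by simp
  then have "norm w \<le> 1" using t by simp
  moreover have "adj w = w" by (simp add: w_def adj_diff adj_scaleR sa)
  ultimately obtain b where b: "adj b = b" "b * b = 1 - w" "norm (1 - b) \<le> 1"
    "\<And>z. z * w = w * z \<Longrightarrow> z * b = b * z"
    using exists_sqrt_unit_ball by blast
  define k where "k = sqrt t *\<^sub>R b"
  have "sqrt t *\<^sub>R 1 - k = sqrt t *\<^sub>R (1 - b)" by (simp add: k_def algebra_simps)
  then have "norm (sqrt t *\<^sub>R 1 - k) \<le> sqrt t"
    using mult_left_mono[OF b(3), of "sqrt t"] t by simp
  then have "positive k"
    using b(1) t unfolding positive_def by (auto simp: k_def adj_scaleR intro!: exI[of _ "sqrt t"])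
  moreover have "k * k = p" using t by (simp add: k_def b(2) w_def)
  moreover have "z * k = k * z" if "z * p = p * z" for z
    using b(4)[of z] that by (simp add: k_def w_def algebra_simps)
  ultimately show ?thesis using that by blast
qed

lemma positive_selfadjoint: "positive a \<Longrightarrow> adj a = a"
  by (simp add: positive_def)

text \<open>The cross terms of \<open>adj (b + \<i> k) * (b + \<i> k)\<close> cancel because
  \<open>b\<close> and \<open>k\<close> commute.\<close>

lemma norm_sq_commuting_sum:
  fixes b k :: "'a::cstar_algebra"
  assumes "adj b = b" "adj k = k" "b * k = k * b"
  shows "(norm (b + \<i> *\<^sub>C k))\<^sup>2 = norm (b * b + k * k)"
proof -
  have "adj (b + \<i> *\<^sub>C k) * (b + \<i> *\<^sub>C k) = b * b + k * k"
    using assms by (simp add: adj_add adj_scaleC scaleC_simps algebra_simps)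
  then show ?thesis by (metis cstar_identity)
qed

lemma real_part_norm_le:
  fixes b k :: "'a::cstar_algebra"
  assumes "adj b = b" "adj k = k"
  shows "norm b \<le> norm (b + \<i> *\<^sub>C k)"
proof -
  have "2 *\<^sub>R b = (b + \<i> *\<^sub>C k) + adj (b + \<i> *\<^sub>C k)"
    using assms by (simp add: adj_add adj_scaleC scaleC_minus_left scaleR_2)
  then have "norm (2 *\<^sub>R b) \<le> norm (b + \<i> *\<^sub>C k) + norm (adj (b + \<i> *\<^sub>C k))"
    by (metis norm_triangle_ineq)
  then show ?thesis by simp
qed

text \<open>With \<open>t = (norm k)\<^sup>2\<close>, the element \<open>t - k * k\<close> has
  distance \<open>t\<close> from \<open>t\<close>, so it has a root \<open>b\<close>, which commutes
  with \<open>k\<close>. Then \<open>b + \<i> k\<close> has squared norm \<open>t\<close>, which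
  bounds \<open>(norm b)\<^sup>2 = norm (t - k * k)\<close>.\<close>

lemma positive_square:
  fixes k :: "'a::cstar_algebra"
  assumes sa: "adj k = k"
  shows "positive (k * k)"
proof -
  define t where "t = (norm k)\<^sup>2"
  have nk: "norm (k * k) = t" using norm_square_selfadjoint[OF sa] by (simp add: t_def)
  have "positive (t *\<^sub>R 1 - k * k)"
    unfolding positive_def using nk sa
    by (auto simp: adj_diff adj_scaleR adj_mult t_def intro!: exI[of _ t])
  then obtain b where b: "positive b" "b * b = t *\<^sub>R 1 - k * k"
    "\<And>z. z * (t *\<^sub>R 1 - k * k) = (t *\<^sub>R 1 - k * k) * z \<Longrightarrow> z * b = b * z"
    using positive_sqrt by blast
  have "k * b = b * k" by (rule b(3)) (simp add: algebra_simps)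
  then have "(norm (b + \<i> *\<^sub>C k))\<^sup>2 = norm (b * b + k * k)"
    using norm_sq_commuting_sum[of b k] sa positive_selfadjoint[OF b(1)] by simp
  also have "\<dots> = t" by (simp add: b(2) t_def)
  finally have "(norm b)\<^sup>2 \<le> t"
    using real_part_norm_le[of b k] sa positive_selfadjoint[OF b(1)]
    by (metis norm_ge_zero power_mono)
  then have "norm (t *\<^sub>R 1 - k * k) \<le> t"
    using norm_square_selfadjoint[OF positive_selfadjoint[OF b(1)]] by (simp add: b(2))
  then show ?thesis using sa unfolding positive_def
    by (auto simp: adj_mult t_def intro!: exI[of _ t])
qed

text \<open>The roots \<open>k\<close> of \<open>c\<close> and \<open>l\<close> of
  \<open>- c\<close> commute and \<open>k * k + l * l = 0\<close>, so \<open>k + \<i> l\<close>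
  vanishes, and with it its real part \<open>k\<close>.\<close>

lemma positive_antisym:
  fixes c :: "'a::cstar_algebra"
  assumes "positive c" "positive (- c)"
  shows "c = 0"
proof -
  obtain k where k: "positive k" "k * k = c" "\<And>z. z * c = c * z \<Longrightarrow> z * k = k * z"
    using positive_sqrt[OF assms(1)] by blast
  obtain l where l: "positive l" "l * l = - c"
    "\<And>z. z * (- c) = (- c) * z \<Longrightarrow> z * l = l * z"
    using positive_sqrt[OF assms(2)] by blast
  have "k * c = c * k" using k(2) by (metis mult.assoc)
  then have "k * l = l * k" by (intro l(3)) simp
  then have "(norm (k + \<i> *\<^sub>C l))\<^sup>2 = norm (k * k + l * l)"
    using norm_sq_commuting_sum k(1) l(1) positive_selfadjoint by blast
  then have "norm (k + \<i> *\<^sub>C l) = 0" by (simp add: k(2) l(2))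
  then have "norm k = 0"
    using real_part_norm_le[of k l] positive_selfadjoint k(1) l(1)
    by (metis norm_ge_zero order_antisym)
  then show ?thesis using k(2) by simp
qed

text \<open>
  Replaces the usual comparison of the spectra of \<open>b * adj b\<close> and \<open>adj b * b\<close>: with
  \<open>w = t - adj b * b\<close> one has \<open>w ^ n * (t - w) = adj b * (t - b * adj b) ^ n * b\<close>, so
  \<open>norm (w ^ n)\<close> exceeds \<open>t ^ n\<close> by at most a factor linear in \<open>n\<close>.
\<close>

lemma positive_adj_mult_swap:
  fixes b :: "'a::cstar_algebra"
  assumes "positive (b * adj b)"
  shows "positive (adj b * b)"
proof -
  obtain t where t: "t > 0" "norm (t *\<^sub>R 1 - b * adj b) \<le> t"
    using positive_bound[OF assms] .
  define v where "v = t *\<^sub>R 1 - b * adj b"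
  define w where "w = t *\<^sub>R 1 - adj b * b"
  define K where "K = (norm b)\<^sup>2 / t"
  have sa: "adj w = w" by (simp add: w_def adj_diff adj_scaleR adj_mult adj_adj)
  have inter: "w ^ n * adj b = adj b * v ^ n" for n
  proof (induction n)
    case (Suc n)
    have "w ^ Suc n * adj b = w * (w ^ n * adj b)" by (simp add: mult.assoc)
    also have "\<dots> = (w * adj b) * v ^ n" by (simp add: Suc mult.assoc)
    also have "w * adj b = adj b * v" by (simp add: w_def v_def algebra_simps)
    finally show ?case by (simp add: mult.assoc)
  qed simp
  have step: "norm (w ^ Suc n) \<le> t * norm (w ^ n) + K * t ^ Suc n" for n
  proof -
    have "w ^ Suc n = w ^ n * w" by (simp add: power_commutes)
    \<comment> \<open>Only the last factor \<open>w\<close> is unfolded, so that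
      \<open>w ^ n * adj b\<close> can be moved across by \<open>inter\<close>.\<close>
    also have "\<dots> = t *\<^sub>R w ^ n - w ^ n * adj b * b"
      by (subst (2) w_def) (simp add: algebra_simps)
    also have "\<dots> = t *\<^sub>R w ^ n - adj b * v ^ n * b" by (simp add: inter)
    finally have "norm (w ^ Suc n) \<le> norm (t *\<^sub>R w ^ n) + norm (adj b * v ^ n * b)"
      by (metis norm_triangle_ineq4)
    also have "norm (adj b * v ^ n * b) \<le> norm (adj b * v ^ n) * norm b"
      by (rule norm_mult_ineq)
    also have "norm (adj b * v ^ n) \<le> norm b * norm (v ^ n)"
      using norm_mult_ineq[of "adj b" "v ^ n"] by simp
    also have "norm (v ^ n) \<le> t ^ n"
      using norm_power_ineq[of v n] power_mono[of "norm v" t n] t by (simp add: v_def)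
    also have "norm b * t ^ n * norm b = K * t ^ Suc n"
      using t by (simp add: K_def power2_eq_square)
    finally show ?thesis using t by (simp add: mult_right_mono mult_left_mono)
  qed
  have K: "K \<ge> 0" using t by (simp add: K_def)
  have bound: "norm (w ^ n) \<le> t ^ n * (1 + real n * K)" for n
  proof (induction n)
    case (Suc n)
    have "norm (w ^ Suc n) \<le> t * (t ^ n * (1 + real n * K)) + K * t ^ Suc n"
      using step[of n] Suc t by (smt (verit) mult_left_mono)
    also have "\<dots> = t ^ Suc n * (1 + real (Suc n) * K)" by (simp add: algebra_simps)
    finally show ?case .
  qed simp
  have "norm w \<le> t"
  \<comment> \<open>For \<open>norm w > t\<close> the quotient \<open>(norm w / t) ^ n\<close> grows
    exponentially, yet along \<open>n = 2 ^ m\<close> it is at most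
    \<open>1 + n * K\<close>.\<close>
  proof (rule ccontr)
    assume "\<not> norm w \<le> t"
    then have r: "norm w / t > 1" using t by simp
    have le: "(norm w / t) ^ (2 ^ m) \<le> 1 + real (2 ^ m) * K" for m
    proof -
      have "norm w ^ (2 ^ m) \<le> t ^ (2 ^ m) * (1 + real (2 ^ m) * K)"
        using bound[of "2 ^ m"] norm_power_two_power_selfadjoint[OF sa, of m] by simp
      then show ?thesis using t by (simp add: power_divide field_simps)
    qed
    define q where "q = t / norm w"
    have q: "\<bar>q\<bar> < 1" using r t by (simp add: q_def divide_simps split: if_splits)
    have "(\<lambda>n. q ^ n + real n * q ^ n * K) \<longlonglongrightarrow> 0 + 0 * K"
      using q by (intro tendsto_intros LIMSEQ_power_zero powser_times_n_limit_0) auto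
    then have "(\<lambda>n. (1 + real n * K) / (norm w / t) ^ n) \<longlonglongrightarrow> 0"
      by (simp add: q_def power_divide algebra_simps add_divide_distrib)
    then have "((\<lambda>m. (1 + real (2 ^ m) * K) / (norm w / t) ^ (2 ^ m)) \<longlongrightarrow> 0) sequentially"
      by (rule filterlim_compose) (rule filterlim_subseq, auto simp: strict_mono_def)
    moreover have "(1 + real (2 ^ m) * K) / (norm w / t) ^ (2 ^ m) \<ge> 1" for m
      using le[of m] r by (simp add: pos_le_divide_eq)
    ultimately show False
      using LIMSEQ_le_const[of _ 0 1] by force
  qed
  then show ?thesis using t
    unfolding positive_def by (auto simp: w_def adj_mult adj_adj intro!: exI[of _ t])
qed

text \<open>
  Kaplansky's argument: if \<open>m\<close> is the negative part of \<open>adj a * a\<close> and \<open>b = a * m\<close>, then both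
  \<open>- adj b * b = m ^ 3\<close> and \<open>adj b * b\<close> are positive, hence \<open>m = 0\<close>.
\<close>

theorem positive_adj_mult:
  fixes a :: "'a::cstar_algebra"
  shows "positive (adj a * a)"
proof -
  define h where "h = adj a * a"
  have sah: "adj h = h" by (simp add: h_def adj_mult adj_adj)
  \<comment> \<open>\<open>k\<close> is the absolute value of \<open>h\<close>.\<close>
  obtain k where k: "positive k" "k * k = h * h" "\<And>z. z * (h * h) = (h * h) * z \<Longrightarrow> z * k = k * z"
    using positive_sqrt[OF positive_square[OF sah]] by blast
  have hk: "h * k = k * h" by (rule k(3)) (simp add: mult.assoc)
  \<comment> \<open>The root of the absolute value serves to write \<open>m ^ 3 = k * m * m\<close>
    as the square of the selfadjoint element \<open>l * m\<close>.\<close>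
  obtain l where l: "positive l" "l * l = k" "\<And>z. z * k = k * z \<Longrightarrow> z * l = l * z"
    using positive_sqrt[OF k(1)] by blast
  have hl: "h * l = l * h" by (rule l(3)[OF hk])
  have kl: "k * l = l * k" by (rule l(3)) simp
  define m where "m = (1/2) *\<^sub>R (k - h)"
  have sam: "adj m = m"
    using sah positive_selfadjoint[OF k(1)] by (simp add: m_def adj_scaleR adj_diff)
  have lm: "l * m = m * l" using hl kl by (simp add: m_def algebra_simps)
  have mm: "m * m = (1/2) *\<^sub>R (k * k - h * k)"
    by (simp add: m_def algebra_simps hk k(2) flip: scaleR_add_left)
  \<comment> \<open>Together with \<open>km\<close> this says \<open>(h + k) * m = 0\<close>: the
    positive and negative parts of \<open>h\<close> are orthogonal.\<close>
  have hm: "h * m = - (m * m)"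
    by (simp add: mm) (simp add: m_def algebra_simps k(2))
  have km: "k * m = m * m"
    by (simp add: mm) (simp add: m_def algebra_simps hk)
  define c where "c = m * m * m"
  have sal: "adj l = l" using l(1) by (rule positive_selfadjoint)
  have "c = k * m * m" by (simp add: c_def km)
  also have "\<dots> = (l * m) * (l * m)" using lm l(2) by (metis mult.assoc)
  also have "positive \<dots>"
    by (rule positive_square) (simp add: adj_mult sam sal lm)
  finally have c: "positive c" .
  define b where "b = a * m"
  have bb: "adj b * b = - c"
  proof -
    have "adj b * b = m * (h * m)" by (simp add: b_def adj_mult sam h_def mult.assoc)
    then show ?thesis by (simp add: hm c_def mult.assoc)
  qed
  \<comment> \<open>Up to factors, the real and imaginary parts of \<open>b\<close>. Their squares
    add up to \<open>2 (b * adj b + adj b * b)\<close>, so \<open>b * adj b\<close> is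
    \<open>(e * e + f * f) / 2 + c\<close>, a sum of positive elements.\<close>
  define e f where "e = b + adj b" and "f = \<i> *\<^sub>C (b - adj b)"
  have "positive (e * e)" "positive (f * f)"
    by (auto intro!: positive_square
        simp: e_def f_def adj_add adj_adj adj_scaleC adj_diff scaleC_simps add.commute)
  then have "positive ((1/2) *\<^sub>R (e * e + f * f) + c)"
    by (intro positive_add positive_scaleR c) auto
  moreover have "e * e + f * f = 2 *\<^sub>R (b * adj b + adj b * b)"
    by (simp add: e_def f_def scaleC_simps algebra_simps scaleR_2)
  ultimately have "positive (b * adj b)" by (simp add: bb)
  then have "positive (- c)" using positive_adj_mult_swap[of b] bb by simp
  with c have "c = 0" by (rule positive_antisym)
  \<comment> \<open>From \<open>m ^ 4 = 0\<close>, the \<open>C\<^sup>*\<close>-identity applied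
    twice gives \<open>m = 0\<close>.\<close>
  then have "(m * m) * (m * m) = 0" by (simp add: c_def mult.assoc)
  then have "norm ((m * m) * (m * m)) = 0" by simp
  then have "m = 0"
    using norm_square_selfadjoint[of "m * m"] norm_square_selfadjoint[OF sam]
    by (simp add: adj_mult sam)
  then have "h = k" by (simp add: m_def)
  then show ?thesis using k(1) by (simp add: h_def)
qed

subsection \<open>Resolvents\<close>

lemma alg_inv_eqI:
  assumes "a * b = 1" "b * a = (1::'a::ring_1)"
  shows "alg_inv a = b"
  unfolding alg_inv_def
proof (rule some_equality)
  fix c assume c: "a * c = 1 \<and> c * a = 1"
  have "c = c * (a * b)" using assms by simp
  also have "\<dots> = (c * a) * b" by (simp only: mult.assoc)
  finally show "c = b" using c by simp
qed (use assms in simp)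

lemma one_minus_geometric_suminf:
  fixes u :: "'a::{real_normed_algebra_1,banach}"
  assumes "norm u < 1"
  shows "(1 - u) * (\<Sum>n. u ^ n) = 1" "(\<Sum>n. u ^ n) * (1 - u) = 1"
proof -
  have s: "summable (\<lambda>n. u ^ n)" by (rule complete_algebra_summable_geometric[OF assms])
  have t: "(\<lambda>n. u ^ n - u ^ Suc n) sums (u ^ 0 - 0)"
    by (intro telescope_sums' LIMSEQ_power_zero assms)
  have "(\<lambda>n. (1 - u) * u ^ n) sums ((1 - u) * (\<Sum>n. u ^ n))"
    by (intro sums_mult summable_sums s)
  with t show "(1 - u) * (\<Sum>n. u ^ n) = 1"
    by (auto simp: algebra_simps dest: sums_unique2)
  have "(\<lambda>n. u ^ n * (1 - u)) sums ((\<Sum>n. u ^ n) * (1 - u))"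
    by (intro sums_mult2 summable_sums s)
  with t show "(\<Sum>n. u ^ n) * (1 - u) = 1"
    by (auto simp: algebra_simps power_commutes dest: sums_unique2)
qed

text \<open>
  A non-real \<open>\<zeta>\<close> may be far closer to the spectrum of \<open>a\<close> than the obvious centre \<open>t\<close>; moving
  the centre to \<open>t + \<i> s\<close> away from \<open>\<zeta>\<close> makes the disc flat enough to exclude \<open>\<zeta>\<close>.
\<close>

lemma positive_separating_disc:
  fixes a :: "'a::cstar_algebra"
  assumes a: "positive a" and \<zeta>: "\<zeta> \<notin> \<real>\<^sub>\<ge>\<^sub>0"
  obtains c where "norm (a - c *\<^sub>C 1) < cmod (\<zeta> - c)"
proof -
  obtain t where t: "t > 0" "norm (t *\<^sub>R 1 - a) \<le> t"
    using positive_bound[OF a] .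
  \<comment> \<open>For non-real \<open>\<zeta>\<close> this value makes
    \<open>(Im \<zeta> - s)\<^sup>2\<close> exceed \<open>t\<^sup>2 + s\<^sup>2\<close>, the bound
    on the squared radius. A real \<open>\<zeta>\<close> is negative, and the centre
    \<open>t\<close> itself works.\<close>
  define s where "s = (if Im \<zeta> = 0 then 0 else - (t\<^sup>2 + 1) / (2 * Im \<zeta>))"
  define c where "c = Complex t s"
  have "c *\<^sub>C (1::'a) = t *\<^sub>R 1 + \<i> *\<^sub>C s *\<^sub>R 1"
    by (simp add: scaleR_scaleC scaleC_scaleC flip: scaleC_add_left)
      (simp add: c_def Complex_eq)
  then have c1: "c *\<^sub>C 1 - a = (t *\<^sub>R 1 - a) + \<i> *\<^sub>C s *\<^sub>R 1" by simp
  have "(norm (c *\<^sub>C 1 - a))\<^sup>2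
      = norm ((t *\<^sub>R 1 - a) * (t *\<^sub>R 1 - a) + (s *\<^sub>R 1) * (s *\<^sub>R (1::'a)))"
    unfolding c1 using positive_selfadjoint[OF a]
    by (intro norm_sq_commuting_sum) (auto simp: adj_diff adj_scaleR)
  also have "\<dots> \<le> norm (t *\<^sub>R 1 - a) * norm (t *\<^sub>R 1 - a) + norm (s *\<^sub>R 1 :: 'a) * norm (s *\<^sub>R 1 :: 'a)"
    by (intro order_trans[OF norm_triangle_ineq] add_mono norm_mult_ineq)
  also have "\<dots> \<le> t\<^sup>2 + s\<^sup>2"
    using t mult_mono[OF t(2) t(2)] by (simp add: power2_eq_square)
  also have "\<dots> < (cmod (\<zeta> - c))\<^sup>2"
  proof (cases "Im \<zeta> = 0")
    case True
    then have "Re \<zeta> < 0" using \<zeta> by (auto simp: complex_nonneg_Reals_iff)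
    then have "t * t < (t - Re \<zeta>) * (t - Re \<zeta>)" using t by (intro mult_strict_mono) auto
    then show ?thesis using True
      by (simp add: cmod_power2 c_def s_def) (simp add: power2_eq_square algebra_simps)
  next
    case False
    then have "2 * Im \<zeta> * s = - (t\<^sup>2 + 1)" by (simp add: s_def)
    then have "(Im \<zeta> - s)\<^sup>2 = (Im \<zeta>)\<^sup>2 + s\<^sup>2 + t\<^sup>2 + 1"
      by (simp add: power2_diff)
    moreover have "(cmod (\<zeta> - c))\<^sup>2 = (Re \<zeta> - t)\<^sup>2 + (Im \<zeta> - s)\<^sup>2"
      by (simp add: cmod_power2 c_def)
    ultimately show ?thesis by (smt (verit) zero_le_power2)
  qed
  finally have "norm (c *\<^sub>C 1 - a) < cmod (\<zeta> - c)"
    by (rule power_less_imp_less_base) simp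
  then show ?thesis using that[of c] by (simp add: norm_minus_commute)
qed

text \<open>Neumann series in \<open>(a - c) / (\<zeta> - c)\<close> for the centre \<open>c\<close>
  of a separating disc. In the conclusion \<open>c\<close> is \<open>1 / (\<zeta> - centre)\<close>
  and \<open>e\<close> is minus the centre; the explicit series shows \<open>R\<close> as a limit of
  polynomials in \<open>a\<close>, which the parity argument uses.\<close>

lemma positive_resolvent:
  fixes a :: "'a::cstar_algebra"
  assumes a: "positive a" and \<zeta>: "\<zeta> \<notin> \<real>\<^sub>\<ge>\<^sub>0"
  obtains R c e where "R * (\<zeta> *\<^sub>C 1 - a) = 1" "(\<zeta> *\<^sub>C 1 - a) * R = 1"
    "(\<lambda>n. c *\<^sub>C (c *\<^sub>C (a + e *\<^sub>C 1)) ^ n) sums R"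
proof -
  obtain c where c: "norm (a - c *\<^sub>C 1) < cmod (\<zeta> - c)"
    using positive_separating_disc[OF assms] .
  define d where "d = \<zeta> - c"
  have d: "d \<noteq> 0" using c by (auto simp: d_def)
  define u where "u = (1 / d) *\<^sub>C (a + (- c) *\<^sub>C 1)"
  have "norm u < 1"
    using c d by (simp add: u_def norm_scaleC norm_divide divide_simps scaleC_minus_left d_def)
  note g = one_minus_geometric_suminf[OF this] complete_algebra_summable_geometric[OF this]
  define R where "R = (1 / d) *\<^sub>C (\<Sum>n. u ^ n)"
  have "\<zeta> *\<^sub>C 1 - a = d *\<^sub>C (1 - u)"
    using d by (simp add: u_def scaleC_simps) (simp add: d_def scaleC_simps)
  then have "R * (\<zeta> *\<^sub>C 1 - a) = 1" "(\<zeta> *\<^sub>C 1 - a) * R = 1"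
    using g d by (simp_all add: R_def mult_scaleC_left mult_scaleC_right scaleC_scaleC)
  moreover have "bounded_linear (\<lambda>b::'a. (1 / d) *\<^sub>C b)"
    by (rule bounded_linear_intro[where K="cmod (1/d)"])
      (auto simp: scaleC_simps scaleC_scaleR norm_scaleC mult.commute)
  then have "(\<lambda>n. (1 / d) *\<^sub>C u ^ n) sums R"
    unfolding R_def by (rule bounded_linear.sums) (rule summable_sums[OF g(3)])
  ultimately show ?thesis using that unfolding u_def by blast
qed

subsection \<open>States\<close>

lemma nc_stateD:
  assumes "nc_state \<phi>"
  shows "\<phi> (a + b) = \<phi> a + \<phi> b" "\<phi> (c *\<^sub>C a) = c * \<phi> a" "\<phi> 1 = 1"
    "\<phi> (adj a * a) \<in> \<real>\<^sub>\<ge>\<^sub>0"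
  using assms by (auto simp: nc_state_def)

lemma nc_state_zero:
  assumes "nc_state \<phi>"
  shows "\<phi> 0 = 0"
  using nc_stateD(2)[OF assms, of 0 0] by simp

lemma nc_state_diff:
  assumes "nc_state \<phi>"
  shows "\<phi> (a - b) = \<phi> a - \<phi> b"
  using nc_stateD(1)[OF assms, of a "(-1) *\<^sub>C b"] nc_stateD(2)[OF assms, of "-1" b]
  by (simp add: scaleC_minus_left)

lemma nc_state_positive:
  assumes "nc_state \<phi>" "positive a"
  shows "\<phi> a \<in> \<real>\<^sub>\<ge>\<^sub>0"
proof -
  obtain k where "positive k" "k * k = a"
    using positive_sqrt[OF assms(2)] by metis
  then show ?thesis using nc_stateD(4)[OF assms(1), of k] positive_selfadjoint by metis
qed

text \<open>Both \<open>norm h - h\<close> and \<open>norm h + h\<close> are positive.\<close>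

lemma nc_state_selfadjoint_bound:
  fixes h :: "'a::cstar_algebra"
  assumes \<phi>: "nc_state \<phi>" and h: "adj h = h"
  shows "cmod (\<phi> h) \<le> norm h"
proof -
  have pos: "positive (norm h *\<^sub>R 1 - h)" "positive (norm h *\<^sub>R 1 + h)"
    using h by (auto simp: positive_def adj_diff adj_add adj_scaleR intro!: exI[of _ "norm h"])
  have "complex_of_real (norm h) - \<phi> h \<in> \<real>\<^sub>\<ge>\<^sub>0" "complex_of_real (norm h) + \<phi> h \<in> \<real>\<^sub>\<ge>\<^sub>0"
    using pos[THEN nc_state_positive[OF \<phi>]]
    by (simp_all add: nc_state_diff[OF \<phi>] nc_stateD[OF \<phi>] scaleR_scaleC)
  then have "Im (\<phi> h) = 0" "\<bar>Re (\<phi> h)\<bar> \<le> norm h"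
    by (auto simp: complex_nonneg_Reals_iff)
  then show ?thesis by (simp add: cmod_eq_Re)
qed

text \<open>Splitting into real and imaginary parts gives the crude constant 2; continuity suffices
  for passing \<open>\<phi>\<close> through the resolvent series.\<close>

lemma nc_state_bounded_linear:
  fixes \<phi> :: "'a::cstar_algebra \<Rightarrow> complex"
  assumes \<phi>: "nc_state \<phi>"
  shows "bounded_linear \<phi>"
proof (rule bounded_linear_intro[where K=2])
  fix a :: 'a
  define h k where "h = a + adj a" and "k = \<i> *\<^sub>C (a - adj a)"
  have sa: "adj h = h" "adj k = k"
    by (auto simp: h_def k_def adj_add adj_adj adj_scaleC adj_diff scaleC_simps)
  have "norm h \<le> 2 * norm a" "norm k \<le> 2 * norm a"
    using norm_triangle_ineq[of a "adj a"] norm_triangle_ineq4[of a "adj a"]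
    by (auto simp: h_def k_def norm_scaleC)
  then have "cmod (\<phi> h) \<le> 2 * norm a" "cmod (\<phi> k) \<le> 2 * norm a"
    using sa[THEN nc_state_selfadjoint_bound[OF \<phi>]] by linarith+
  moreover have "2 *\<^sub>C a = h + (- \<i>) *\<^sub>C k"
  proof -
    have "h + (- \<i>) *\<^sub>C k = 1 *\<^sub>C a + 1 *\<^sub>C a"
      by (simp add: h_def k_def scaleC_simps)
    then show ?thesis by (simp only: flip: scaleC_add_left) simp
  qed
  then have "2 * \<phi> a = \<phi> h + (- \<i>) * \<phi> k"
    by (metis nc_stateD(1,2)[OF \<phi>])
  then have "cmod (2 * \<phi> a) \<le> cmod (\<phi> h) + cmod (\<phi> k)"
    by (metis norm_triangle_ineq norm_mult norm_minus_cancel norm_ii mult_1)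
  ultimately show "norm (\<phi> a) \<le> norm a * 2" by (simp add: norm_mult)
qed (auto simp: nc_stateD[OF \<phi>] scaleR_scaleC scaleR_conv_of_real)

subsection \<open>Odd moments of circular elements\<close>

lemma semicircular_odd_moment:
  assumes "semicircular \<phi> \<sigma> s" "odd k"
  shows "\<phi> (s ^ k) = 0"
proof -
  define f where "f t = t ^ k * (sqrt (4 * \<sigma>\<^sup>2 - t\<^sup>2) / (2 * pi * \<sigma>\<^sup>2))" for t :: real
  have odd_f: "f (- t) = - f t" for t using \<open>odd k\<close> by (simp add: f_def)
  have "integral {- 2 * \<sigma>..2 * \<sigma>} (\<lambda>t. f (- t)) = integral {- 2 * \<sigma>..2 * \<sigma>} f"
    using Henstock_Kurzweil_Integration.integral_reflect_real[of "2 * \<sigma>" "- 2 * \<sigma>" f] by simp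
  then have "integral {- 2 * \<sigma>..2 * \<sigma>} f = 0" by (simp add: odd_f)
  moreover have "\<phi> (s ^ k) = complex_of_real (integral {- 2 * \<sigma>..2 * \<sigma>} f)"
    using assms(1) unfolding semicircular_def f_def by blast
  ultimately show ?thesis by simp
qed

definition centered_power :: "('a::cstar_algebra \<Rightarrow> complex) \<Rightarrow> ('i \<Rightarrow> 'a) \<Rightarrow> 'i \<times> nat \<Rightarrow> 'a" where
  "centered_power \<phi> g = (\<lambda>(i, k). g i ^ k - \<phi> (g i ^ k) *\<^sub>C 1)"

inductive_set alternating_span ::
  "('a::cstar_algebra \<Rightarrow> complex) \<Rightarrow> ('i \<Rightarrow> 'a) \<Rightarrow> bool \<Rightarrow> 'a set" for \<phi> g p where
  word: "distinct_adj (map fst xs) \<Longrightarrow> even (sum_list (map snd xs)) = p \<Longrightarrow>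
    prod_list (map (centered_power \<phi> g) xs) \<in> alternating_span \<phi> g p"
| add: "a \<in> alternating_span \<phi> g p \<Longrightarrow> b \<in> alternating_span \<phi> g p \<Longrightarrow>
    a + b \<in> alternating_span \<phi> g p"
| scale: "a \<in> alternating_span \<phi> g p \<Longrightarrow> c *\<^sub>C a \<in> alternating_span \<phi> g p"

lemma alternating_span_one: "1 \<in> alternating_span \<phi> g True"
  using alternating_span.word[of "[]" True \<phi> g] by simp

text \<open>A new letter either lengthens the word or merges with an equal first letter. Merging
  creates correction terms of lower degree; those of the wrong parity carry an odd moment as
  coefficient and vanish.\<close>

lemma alternating_span_mult_generator:
  fixes g :: "'i \<Rightarrow> 'a::cstar_algebra"
  assumes odd0: "\<And>i k. odd k \<Longrightarrow> \<phi> (g i ^ k) = 0"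
    and v: "v \<in> alternating_span \<phi> g p"
  shows "g i * v \<in> alternating_span \<phi> g (\<not> p)"
  using v
proof induction
  case (word xs)
  have g: "g i = centered_power \<phi> g (i, 1)"
    using odd0[of 1 i] by (simp add: centered_power_def)
  show ?case
  proof (cases "xs = [] \<or> fst (hd xs) \<noteq> i")
    case True
    then have "distinct_adj (map fst ((i, 1) # xs))"
      using word by (cases xs) auto
    then show ?thesis
      using alternating_span.word[of "(i, 1) # xs" "\<not> p" \<phi> g] word g by simp
  next
    case False
    then obtain k ys where xs: "xs = (i, k) # ys" by (cases xs) auto
    define Y where "Y = prod_list (map (centered_power \<phi> g) ys)"
    have ys: "distinct_adj (map fst ys)" using word xs distinct_adj_ConsD by fastforce
    have d: "distinct_adj (map fst ((i, l) # ys))" for l using word xs by simp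
    have expand: "g i * (centered_power \<phi> g (i, k) * Y) =
        centered_power \<phi> g (i, Suc k) * Y + \<phi> (g i ^ Suc k) *\<^sub>C Y
        + (- \<phi> (g i ^ k)) *\<^sub>C (centered_power \<phi> g (i, 1) * Y)"
      using odd0[of 1 i] by (simp add: centered_power_def algebra_simps scaleC_simps)
    have 1: "centered_power \<phi> g (i, Suc k) * Y \<in> alternating_span \<phi> g (\<not> p)"
      using alternating_span.word[OF d[of "Suc k"], of "\<not> p" \<phi> g] word xs by (auto simp: Y_def)
    \<comment> \<open>Removing the letter of degree \<open>k\<close> gives the required parity
      exactly when \<open>k\<close> is odd; otherwise the coefficient is an odd moment.\<close>
    have 2: "\<phi> (g i ^ Suc k) *\<^sub>C Y \<in> alternating_span \<phi> g (\<not> p)"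
    proof (cases "even k")
      case True
      \<comment> \<open>Membership of 0 comes from scaling the element of fact \<open>1\<close> by
        0.\<close>
      then show ?thesis using alternating_span.scale[OF 1, of 0] odd0[of "Suc k" i] by simp
    next
      case False
      then have "Y \<in> alternating_span \<phi> g (\<not> p)"
        using alternating_span.word[OF ys, of "\<not> p" \<phi> g] word xs by (auto simp: Y_def)
      then show ?thesis by (rule alternating_span.scale)
    qed
    \<comment> \<open>Replacing degree \<open>k\<close> by 1 changes the parity as required exactly
      when \<open>k\<close> is even.\<close>
    have 3: "(- \<phi> (g i ^ k)) *\<^sub>C (centered_power \<phi> g (i, 1) * Y) \<in> alternating_span \<phi> g (\<not> p)"
    proof (cases "even k")
      case False
      then show ?thesis using alternating_span.scale[OF 1, of 0] odd0[of k i] by simp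
    next
      case True
      then have "centered_power \<phi> g (i, 1) * Y \<in> alternating_span \<phi> g (\<not> p)"
        using alternating_span.word[OF d[of 1], of "\<not> p" \<phi> g] word xs by (auto simp: Y_def)
      then show ?thesis by (rule alternating_span.scale)
    qed
    show ?thesis
      using alternating_span.add[OF alternating_span.add[OF 1 2] 3] expand by (simp add: xs Y_def)
  qed
next
  case (add a b)
  then show ?case by (simp add: distrib_left alternating_span.add)
next
  case (scale a c)
  then show ?case by (simp add: mult_scaleC_right alternating_span.scale)
qed

lemma unital_subalg_power: "a \<in> S \<Longrightarrow> a ^ n \<in> unital_subalg S"
  by (induction n) (auto intro: unital_subalg.intros)

lemma centered_power_in_unital_subalg:
  "centered_power \<phi> g (i, k) \<in> unital_subalg {g i}"
proof -
  have "g i ^ k + (- \<phi> (g i ^ k)) *\<^sub>C 1 \<in> unital_subalg {g i}"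
    by (intro unital_subalg.add unital_subalg.scale unital_subalg.one unital_subalg_power) simp
  then show ?thesis by (simp add: centered_power_def scaleC_minus_left)
qed

lemma state_alternating_span_odd:
  assumes \<phi>: "nc_state \<phi>" and free: "free_family \<phi> (\<lambda>i. unital_subalg {g i})"
    and v: "v \<in> alternating_span \<phi> g False"
  shows "\<phi> v = 0"
  using v
proof induction
  case (word xs)
  define ys where "ys = map (\<lambda>z. (fst z, centered_power \<phi> g z)) xs"
  \<comment> \<open>Odd degree excludes the empty word, to which freeness does not apply.\<close>
  have "ys \<noteq> []" using word by (auto simp: ys_def)
  moreover have "distinct_adj (map fst ys)" using word by (simp add: ys_def comp_def)
  moreover have "\<forall>(i, a) \<in> set ys. a \<in> unital_subalg {g i} \<and> \<phi> a = 0"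
    by (auto simp: ys_def centered_power_in_unital_subalg)
      (simp add: centered_power_def nc_state_diff[OF \<phi>] nc_stateD[OF \<phi>])
  ultimately have "\<phi> (prod_list (map snd ys)) = 0"
    using free unfolding free_family_def by blast
  then show ?case by (simp add: ys_def comp_def)
qed (auto simp: nc_stateD[OF \<phi>])

text \<open>Packages the two parity spans of the semicirculars: \<open>x\<close> and
  \<open>adj x\<close> are linear combinations of these, so left multiplication by either flips the
  parity.\<close>

lemma circular_grading:
  fixes x :: "'a::cstar_algebra"
  assumes \<phi>: "nc_state \<phi>" and x: "circular \<phi> x"
  obtains V :: "bool \<Rightarrow> 'a set" where
    "1 \<in> V True" "\<And>p a b. a \<in> V p \<Longrightarrow> b \<in> V p \<Longrightarrow> a + b \<in> V p"
    "\<And>p a c. a \<in> V p \<Longrightarrow> c *\<^sub>C a \<in> V p"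
    "\<And>p a. a \<in> V p \<Longrightarrow> x * a \<in> V (\<not> p)" "\<And>p a. a \<in> V p \<Longrightarrow> adj x * a \<in> V (\<not> p)"
    "\<And>a. a \<in> V False \<Longrightarrow> \<phi> a = 0"
proof -
  obtain s1 s2 \<sigma> where s: "semicircular \<phi> \<sigma> s1" "semicircular \<phi> \<sigma> s2" "free_pair \<phi> s1 s2"
    and x_eq: "x = complex_of_real (1 / sqrt 2) *\<^sub>C (s1 + \<i> *\<^sub>C s2)"
    using x unfolding circular_def by blast
  define g where "g i = (if i then s1 else s2)" for i
  define V where "V = alternating_span \<phi> g"
  have sa: "adj s1 = s1" "adj s2 = s2" using s by (auto simp: semicircular_def)
  have odd0: "\<phi> (g i ^ k) = 0" if "odd k" for i k
    using semicircular_odd_moment that s by (auto simp: g_def)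
  have gen: "s1 * a \<in> V (\<not> p)" "s2 * a \<in> V (\<not> p)" if "a \<in> V p" for a p
    using alternating_span_mult_generator[of \<phi> g a p True]
      alternating_span_mult_generator[of \<phi> g a p False] odd0 that
    by (auto simp: V_def g_def)
  have addV: "a + b \<in> V p" if "a \<in> V p" "b \<in> V p" for a b p
    using that by (auto simp: V_def intro: alternating_span.add)
  have scaleV: "c *\<^sub>C a \<in> V p" if "a \<in> V p" for a c p
    using that by (auto simp: V_def intro: alternating_span.scale)
  have comb: "(c *\<^sub>C (s1 + d *\<^sub>C s2)) * a \<in> V (\<not> p)" if "a \<in> V p" for a p c d
    using addV[OF gen(1)[OF that] scaleV[OF gen(2)[OF that], of d]]
    by (simp add: mult_scaleC_left distrib_right scaleV)
  have adj_x: "adj x = complex_of_real (1 / sqrt 2) *\<^sub>C (s1 + (- \<i>) *\<^sub>C s2)"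
    by (simp add: x_eq adj_scaleC adj_add sa)
  show ?thesis
  proof (rule that[of V])
    show "1 \<in> V True" unfolding V_def by (rule alternating_span_one)
    show "\<phi> a = 0" if "a \<in> V False" for a
      using state_alternating_span_odd[OF \<phi>, of g a] s(3) that
      by (simp add: free_pair_def V_def g_def)
  qed (use addV scaleV comb adj_x x_eq in auto)
qed

subsection \<open>The resolvent of the hermitization\<close>

text \<open>Products \<open>y * adj y\<close> and \<open>adj y * y\<close> preserve parity, so the
  resolvents are limits of even elements, and one more factor \<open>y\<close> or
  \<open>adj y\<close> makes every term odd.\<close>

lemma circular_resolvent_odd:
  fixes x :: "'a::cstar_algebra"
  assumes \<phi>: "nc_state \<phi>" and x: "circular \<phi> x" and \<zeta>: "\<zeta> \<notin> \<real>\<^sub>\<ge>\<^sub>0"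
  obtains R S where
    "R * (\<zeta> *\<^sub>C 1 - (d *\<^sub>C x) * adj (d *\<^sub>C x)) = 1" "(\<zeta> *\<^sub>C 1 - (d *\<^sub>C x) * adj (d *\<^sub>C x)) * R = 1"
    "S * (\<zeta> *\<^sub>C 1 - adj (d *\<^sub>C x) * (d *\<^sub>C x)) = 1" "(\<zeta> *\<^sub>C 1 - adj (d *\<^sub>C x) * (d *\<^sub>C x)) * S = 1"
    "\<phi> (adj (d *\<^sub>C x) * R) = 0" "\<phi> ((d *\<^sub>C x) * S) = 0"
proof -
  define y where "y = d *\<^sub>C x"
  obtain V :: "bool \<Rightarrow> 'a set" where V: "1 \<in> V True" "\<And>p a b. a \<in> V p \<Longrightarrow> b \<in> V p \<Longrightarrow> a + b \<in> V p"
    "\<And>p a c. a \<in> V p \<Longrightarrow> c *\<^sub>C a \<in> V p"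
    "\<And>p a. a \<in> V p \<Longrightarrow> x * a \<in> V (\<not> p)" "\<And>p a. a \<in> V p \<Longrightarrow> adj x * a \<in> V (\<not> p)"
    "\<And>a. a \<in> V False \<Longrightarrow> \<phi> a = 0"
    using circular_grading[OF \<phi> x] by blast
  have Vy: "y * a \<in> V (\<not> p)" "adj y * a \<in> V (\<not> p)" if "a \<in> V p" for p a
    using V(3-5) that by (auto simp: y_def mult_scaleC_left adj_scaleC)
  \<comment> \<open>The spans are not known to be closed, so \<open>\<phi>\<close> is applied to the
    series term by term.\<close>
  have odd: "\<phi> (z * T) = 0"
    if T: "(\<lambda>n. c *\<^sub>C (c *\<^sub>C (b + e *\<^sub>C 1)) ^ n) sums T"
      and b: "\<And>a. a \<in> V True \<Longrightarrow> b * a \<in> V True"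
      and z: "\<And>a. a \<in> V True \<Longrightarrow> z * a \<in> V False" for z b c e T
  proof -
    have "(c *\<^sub>C (b + e *\<^sub>C 1)) ^ n \<in> V True" for n
      by (induction n) (auto simp: V b mult_scaleC_left distrib_right)
    then have "\<phi> (z * (c *\<^sub>C (c *\<^sub>C (b + e *\<^sub>C 1)) ^ n)) = 0" for n
      by (intro V(6) z V(3))
    moreover have "(\<lambda>n. \<phi> (z * (c *\<^sub>C (c *\<^sub>C (b + e *\<^sub>C 1)) ^ n))) sums \<phi> (z * T)"
      by (intro bounded_linear.sums[OF nc_state_bounded_linear[OF \<phi>]] sums_mult T)
    ultimately have "(\<lambda>n::nat. 0) sums \<phi> (z * T)" by simp
    then show ?thesis by (simp add: sums_iff)
  qed
  obtain R c e where R: "R * (\<zeta> *\<^sub>C 1 - y * adj y) = 1" "(\<zeta> *\<^sub>C 1 - y * adj y) * R = 1"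
    "(\<lambda>n. c *\<^sub>C (c *\<^sub>C (y * adj y + e *\<^sub>C 1)) ^ n) sums R"
    using positive_resolvent[OF positive_adj_mult[of "adj y", unfolded adj_adj] \<zeta>] .
  obtain S c' e' where S: "S * (\<zeta> *\<^sub>C 1 - adj y * y) = 1" "(\<zeta> *\<^sub>C 1 - adj y * y) * S = 1"
    "(\<lambda>n. c' *\<^sub>C (c' *\<^sub>C (adj y * y + e' *\<^sub>C 1)) ^ n) sums S"
    using positive_resolvent[OF positive_adj_mult[of y] \<zeta>] .
  have "\<phi> (adj y * R) = 0" "\<phi> (y * S) = 0"
    by (rule odd[OF R(3)], use Vy[of _ True] Vy[of _ False] in \<open>auto simp: mult.assoc\<close>)
      (rule odd[OF S(3)], use Vy[of _ True] Vy[of _ False] in \<open>auto simp: mult.assoc\<close>)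
  with R S show ?thesis using that unfolding y_def by blast
qed

text \<open>Rests on \<open>y (\<zeta> - z y) = (\<zeta> - y z) y\<close>.\<close>

lemma resolvent_intertwine:
  fixes y :: "'a::cstar_algebra"
  assumes R: "R * (\<zeta> *\<^sub>C 1 - y * z) = 1" and S: "(\<zeta> *\<^sub>C 1 - z * y) * S = 1"
  shows "y * S = R * y"
proof -
  have "y * S = R * (\<zeta> *\<^sub>C 1 - y * z) * (y * S)" using R by simp
  also have "\<dots> = R * y * ((\<zeta> *\<^sub>C 1 - z * y) * S)"
    by (simp add: algebra_simps mult_scaleC_left mult_scaleC_right)
  finally show ?thesis using S by simp
qed

text \<open>Moves a scalar from the element to the spectral parameter; with \<open>c\<close> the
  squared modulus of \<open>D $ k\<close> it produces the inverse squares in the theorem.\<close>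

lemma alg_inv_scaleC:
  fixes a :: "'a::cstar_algebra"
  assumes "R * (\<zeta> *\<^sub>C 1 - c *\<^sub>C a) = 1" "(\<zeta> *\<^sub>C 1 - c *\<^sub>C a) * R = 1" "c \<noteq> 0"
  shows "alg_inv ((\<zeta> / c) *\<^sub>C 1 - a) = c *\<^sub>C R"
proof (rule alg_inv_eqI)
  have e: "(\<zeta> / c) *\<^sub>C 1 - a = (1 / c) *\<^sub>C (\<zeta> *\<^sub>C 1 - c *\<^sub>C a)"
    using assms(3) by (simp add: scaleC_diff_right scaleC_scaleC)
  show "((\<zeta> / c) *\<^sub>C 1 - a) * c *\<^sub>C R = 1" "c *\<^sub>C R * ((\<zeta> / c) *\<^sub>C 1 - a) = 1"
    unfolding e using assms by (simp_all add: mult_scaleC_left mult_scaleC_right scaleC_scaleC)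
qed

text \<open>The arguments of \<open>p\<close> and \<open>q\<close> lie strictly between 0 and \<pi>,
  so their sum lies strictly between 0 and twice that.\<close>

lemma mult_upper_half_not_nonneg:
  assumes "Im p > 0" "Im q > 0"
  shows "p * q \<notin> \<real>\<^sub>\<ge>\<^sub>0"
proof
  assume "p * q \<in> \<real>\<^sub>\<ge>\<^sub>0"
  then have re: "Re p * Re q \<ge> Im p * Im q" and im: "Re p * Im q = - (Im p * Re q)"
    by (auto simp: complex_nonneg_Reals_iff)
  have "Im p * Im q * (Im q * Im q) \<le> Re p * Re q * (Im q * Im q)"
    using re assms by (intro mult_right_mono) auto
  also have "\<dots> = (Re p * Im q) * Re q * Im q" by (simp add: algebra_simps)
  also have "\<dots> = - (Im p * (Re q * Re q) * Im q)" by (simp only: im) (simp add: algebra_simps)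
  also have "\<dots> \<le> 0" using assms by simp
  finally show False using assms by (simp add: mult_le_0_iff)
qed

text \<open>Test positive definiteness on a standard basis vector.\<close>

lemma upper_half_diagonal:
  assumes "B \<in> upper_half"
  shows "Im (B $ i $ i) > 0"
proof -
  have "0 < Re (\<Sum>k\<in>UNIV. cnj (axis i 1 $ k) * (mat_Im B *v axis i 1) $ k)"
    using assms by (auto simp: upper_half_def pos_definite_def)
  also have "(\<Sum>k\<in>UNIV. cnj (axis i 1 $ k) * (mat_Im B *v axis i 1) $ k)
      = (\<Sum>k\<in>UNIV. if k = i then mat_Im B $ k $ i else 0)"
    by (rule sum.cong) (auto simp: axis_def matrix_vector_mult_def if_distrib cong: if_cong)
  also have "\<dots> = mat_Im B $ i $ i" by simp
  finally show ?thesis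
    by (simp add: mat_Im_def conj_transpose_def complex_diff_cnj)
qed

lemma matrix_inv_eqI:
  fixes A N :: "'a::semiring_1 ^ 'm ^ 'm"
  assumes "A ** N = mat 1" "N ** A = mat 1"
  shows "matrix_inv A = N"
proof -
  have "A ** matrix_inv A = mat 1 \<and> matrix_inv A ** A = mat 1"
    unfolding matrix_inv_def by (rule someI[where x = N]) (use assms in simp)
  then have "matrix_inv A = (N ** A) ** matrix_inv A" "A ** matrix_inv A = mat 1"
    using assms by simp_all
  then show ?thesis by (metis matrix_mul_assoc matrix_mul_rid)
qed

lemma sum_UNIV_sum:
  "(\<Sum>i\<in>(UNIV :: ('n::finite + 'm::finite) set). f i) = (\<Sum>k\<in>UNIV. f (Inl k)) + (\<Sum>k\<in>UNIV. f (Inr k))"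
  using sum.Plus[of UNIV UNIV f] by simp

text \<open>
  After conjugation by the permutation, \<open>J - X\<close> splits into the \<open>2 \<times> 2\<close> blocks
  \<open>(p k, - y k; - adj (y k), q k)\<close> on the index pairs \<open>(Inl k, Inr (\<pi> k))\<close>.
\<close>

lemma matrix_inv_hermitization:
  fixes A N :: "'a::cstar_algebra ^ ('n::finite + 'n) ^ ('n + 'n)"
  assumes \<pi>: "bij \<pi>"
    and A: "A = block_mat (diag_mat (\<chi> k. p k *\<^sub>C 1)) (\<chi> k l. if l = \<pi> k then - y k else 0)
      (\<chi> k l. if k = \<pi> l then - adj (y l) else 0) (diag_mat (\<chi> k. q (inv \<pi> k) *\<^sub>C 1))"
    and N: "N = block_mat (diag_mat (\<chi> k. q k *\<^sub>C R k)) (\<chi> k l. if l = \<pi> k then y k * S k else 0)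
      (\<chi> k l. if k = \<pi> l then adj (y l) * R l else 0) (diag_mat (\<chi> k. p (inv \<pi> k) *\<^sub>C S (inv \<pi> k)))"
    and R: "\<And>k. R k * ((p k * q k) *\<^sub>C 1 - y k * adj (y k)) = 1"
      "\<And>k. ((p k * q k) *\<^sub>C 1 - y k * adj (y k)) * R k = 1"
    and S: "\<And>k. S k * ((p k * q k) *\<^sub>C 1 - adj (y k) * y k) = 1"
      "\<And>k. ((p k * q k) *\<^sub>C 1 - adj (y k) * y k) * S k = 1"
  shows "matrix_inv A = N"
proof (rule matrix_inv_eqI)
  have yS: "y k * S k = R k * y k" for k by (rule resolvent_intertwine[OF R(1) S(2)])
  have yR: "adj (y k) * R k = S k * adj (y k)" for k by (rule resolvent_intertwine[OF S(1) R(2)])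
  have eq: "k = \<pi> l \<longleftrightarrow> l = inv \<pi> k" for k l
    using \<pi> by (metis bij_inv_eq_iff)
  have inv [simp]: "inv \<pi> (\<pi> k) = k" "\<pi> (inv \<pi> k) = k" for k
    using \<pi> by (simp_all add: bij_is_inj bij_is_surj surj_f_inv_f)
  note R' = R[unfolded right_diff_distrib left_diff_distrib mult_scaleC_left mult_scaleC_right mult_1 mult_1_right]
  note S' = S[unfolded right_diff_distrib left_diff_distrib mult_scaleC_left mult_scaleC_right mult_1 mult_1_right]
  \<comment> \<open>Each row and column of \<open>A\<close> has at most two nonzero entries, at the
    indices \<open>Inl k\<close> and \<open>Inr (\<pi> k)\<close> of one block.\<close>
  have A_Inl: "(A ** N) $ Inl k $ j = p k *\<^sub>C N $ Inl k $ j - y k * N $ Inr (\<pi> k) $ j" for k j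
    by (simp add: matrix_matrix_mult_def sum_UNIV_sum A block_mat_def diag_mat_def mult_scaleC_left
        if_distrib[of "\<lambda>z. z * _"] cong: if_cong)
  have A_Inr: "(A ** N) $ Inr (\<pi> k) $ j = q k *\<^sub>C N $ Inr (\<pi> k) $ j - adj (y k) * N $ Inl k $ j" for k j
    by (simp add: matrix_matrix_mult_def sum_UNIV_sum A block_mat_def diag_mat_def mult_scaleC_left
        if_distrib[of "\<lambda>z. z * _"] eq cong: if_cong)
  have N_Inl: "(N ** A) $ i $ Inl l = p l *\<^sub>C N $ i $ Inl l - N $ i $ Inr (\<pi> l) * adj (y l)" for i l
    by (simp add: matrix_matrix_mult_def sum_UNIV_sum A block_mat_def diag_mat_def mult_scaleC_right
        if_distrib[of "\<lambda>z. _ * z"] cong: if_cong)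
  have N_Inr: "(N ** A) $ i $ Inr (\<pi> l) = q l *\<^sub>C N $ i $ Inr (\<pi> l) - N $ i $ Inl l * y l" for i l
    by (simp add: matrix_matrix_mult_def sum_UNIV_sum A block_mat_def diag_mat_def mult_scaleC_right
        if_distrib[of "\<lambda>z. _ * z"] bij_is_inj[OF \<pi>, THEN inj_eq] cong: if_cong)
  have NI [simp]: "N $ Inl k $ Inl l = (if k = l then q k *\<^sub>C R k else 0)"
    "N $ Inl k $ Inr (\<pi> l) = (if k = l then y k * S k else 0)"
    "N $ Inr (\<pi> k) $ Inl l = (if k = l then adj (y l) * R l else 0)"
    "N $ Inr (\<pi> k) $ Inr (\<pi> l) = (if k = l then p k *\<^sub>C S k else 0)" for k l
    using \<pi> by (auto simp: N block_mat_def diag_mat_def bij_is_inj[THEN inj_eq])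
  \<comment> \<open>Writing the lower indices as \<open>\<pi> k\<close> removes
    \<open>inv \<pi>\<close> from all entries.\<close>
  have index: "(\<forall>i. P i) \<longleftrightarrow> (\<forall>k. P (Inl k)) \<and> (\<forall>k. P (Inr (\<pi> k)))" for P :: "'n + 'n \<Rightarrow> bool"
    by (metis inv(2) sum.exhaust)
  show "A ** N = mat 1"
    unfolding vec_eq_iff index A_Inl A_Inr using \<pi> R'(2) S'(2)
    by (auto simp: mat_def scaleC_simps mult.assoc mult.commute[of "q _"] bij_is_inj[THEN inj_eq])
  \<comment> \<open>On this side the intertwining relations are needed to bring the resolvents to
    the left of \<open>y\<close> and \<open>adj y\<close>.\<close>
  show "N ** A = mat 1"
    unfolding vec_eq_iff index N_Inl N_Inr using \<pi> R'(1) S'(1)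
    by (auto simp: mat_def scaleC_simps yS yR mult.assoc mult.commute[of "q _"] bij_is_inj[THEN inj_eq])
qed

text \<open>The vector \<open>g\<close> is existential so that diagonality is asserted for every
  \<open>D\<close>, while each entry formula is tied to a nonzero \<open>D $ k\<close>, where the
  inverse square has its usual meaning.\<close>

theorem theorem4:
  fixes \<phi> :: "'a::cstar_algebra \<Rightarrow> complex"
    and x :: 'a
    and D J1 J2 :: "complex ^ 'n"
    and \<pi> :: "'n \<Rightarrow> 'n"
    and M :: "complex ^ 'n ^ 'n"
    and J :: "complex ^ ('n + 'n) ^ ('n + 'n)"
  assumes "nc_state \<phi>"
    and "circular \<phi> x"
    and "bij \<pi>"
    and "M = diag_mat D ** perm_mat \<pi>"
    and "J = block_mat (diag_mat J1) 0 0 (diag_mat J2)"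
    and "J \<in> upper_half"
  shows "\<exists>g :: complex ^ ('n + 'n).
    mat_cauchy_transform \<phi> (mat_hat M x) J = diag_mat g \<and>
    (\<forall>k. D $ k \<noteq> 0 \<longrightarrow>
       g $ Inl k =
         J2 $ \<pi> k * complex_of_real (cmod (D $ k) powi (-2)) *
         cauchy_transform \<phi> (x * adj x)
           (J1 $ k * J2 $ \<pi> k * complex_of_real (cmod (D $ k) powi (-2)))) \<and>
    (\<forall>k. D $ inv \<pi> k \<noteq> 0 \<longrightarrow>
       g $ Inr k =
         J1 $ inv \<pi> k * complex_of_real (cmod (D $ inv \<pi> k) powi (-2)) *
         cauchy_transform \<phi> (adj x * x)
           (J1 $ inv \<pi> k * J2 $ k * complex_of_real (cmod (D $ inv \<pi> k) powi (-2))))"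
proof -
  note \<phi> = \<open>nc_state \<phi>\<close> and \<pi> = \<open>bij \<pi>\<close>
  \<comment> \<open>The diagonal entries of \<open>J\<close> that meet in block \<open>k\<close>;
    their product is the spectral parameter of that block.\<close>
  define p q where "p k = J1 $ k" and "q k = J2 $ \<pi> k" for k
  define y where "y k = D $ k *\<^sub>C x" for k
  have inv [simp]: "inv \<pi> (\<pi> k) = k" "\<pi> (inv \<pi> k) = k" for k
    using \<pi> by (simp_all add: bij_is_inj bij_is_surj surj_f_inv_f)
  have "Im (J1 $ k) > 0" "Im (J2 $ k) > 0" for k
    using upper_half_diagonal[OF \<open>J \<in> upper_half\<close>, of "Inl k"]
      upper_half_diagonal[OF \<open>J \<in> upper_half\<close>, of "Inr k"]
    by (auto simp: \<open>J = _\<close> block_mat_def diag_mat_def)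
  then have \<zeta>: "p k * q k \<notin> \<real>\<^sub>\<ge>\<^sub>0" for k
    unfolding p_def q_def by (rule mult_upper_half_not_nonneg)
  have "\<exists>R S. R * ((p k * q k) *\<^sub>C 1 - y k * adj (y k)) = 1 \<and>
      ((p k * q k) *\<^sub>C 1 - y k * adj (y k)) * R = 1 \<and>
      S * ((p k * q k) *\<^sub>C 1 - adj (y k) * y k) = 1 \<and>
      ((p k * q k) *\<^sub>C 1 - adj (y k) * y k) * S = 1 \<and>
      \<phi> (adj (y k) * R) = 0 \<and> \<phi> (y k * S) = 0" for k
    unfolding y_def
    using circular_resolvent_odd[OF \<phi> \<open>circular \<phi> x\<close> \<zeta>[of k], of "D $ k"] by metis
  then obtain R S where RS: "\<And>k. R k * ((p k * q k) *\<^sub>C 1 - y k * adj (y k)) = 1"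
      "\<And>k. ((p k * q k) *\<^sub>C 1 - y k * adj (y k)) * R k = 1"
      "\<And>k. S k * ((p k * q k) *\<^sub>C 1 - adj (y k) * y k) = 1"
      "\<And>k. ((p k * q k) *\<^sub>C 1 - adj (y k) * y k) * S k = 1"
      "\<And>k. \<phi> (adj (y k) * R k) = 0" "\<And>k. \<phi> (y k * S k) = 0"
    by metis
  define N where "N = block_mat (diag_mat (\<chi> k. q k *\<^sub>C R k)) (\<chi> k l. if l = \<pi> k then y k * S k else 0)
      (\<chi> k l. if k = \<pi> l then adj (y l) * R l else 0) (diag_mat (\<chi> k. p (inv \<pi> k) *\<^sub>C S (inv \<pi> k)))"
  have M: "M $ k $ l = (if l = \<pi> k then D $ k else 0)" for k l
    by (simp add: \<open>M = _\<close> matrix_matrix_mult_def diag_mat_def perm_mat_def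
        if_distrib[of "\<lambda>z. z * _"] cong: if_cong)
  have A: "mat_embed J - mat_hat M x =
      block_mat (diag_mat (\<chi> k. p k *\<^sub>C 1)) (\<chi> k l. if l = \<pi> k then - y k else 0)
      (\<chi> k l. if k = \<pi> l then - adj (y l) else 0) (diag_mat (\<chi> k. q (inv \<pi> k) *\<^sub>C 1))"
    unfolding vec_eq_iff
    by (auto simp: mat_embed_def mat_hat_def block_mat_def diag_mat_def \<open>J = _\<close> M mat_scale_def
        conj_transpose_def p_def q_def y_def adj_scaleC split: sum.splits)
  have "matrix_inv (mat_embed J - mat_hat M x) = N"
    using RS by (intro matrix_inv_hermitization[OF \<pi> A N_def])
  then have G: "mat_cauchy_transform \<phi> (mat_hat M x) J = mat_expect \<phi> N"
    by (simp add: mat_cauchy_transform_def)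
  define g :: "complex ^ ('n + 'n)" where
    "g = (\<chi> i. case i of Inl k \<Rightarrow> q k * \<phi> (R k) | Inr k \<Rightarrow> p (inv \<pi> k) * \<phi> (S (inv \<pi> k)))"
  \<comment> \<open>The off-diagonal blocks of \<open>N\<close> consist of 0 and the products
    \<open>y k * S k\<close> and \<open>adj (y k) * R k\<close>, on which \<open>\<phi>\<close>
    vanishes.\<close>
  have "mat_expect \<phi> N = diag_mat g"
    unfolding vec_eq_iff
    by (auto simp: mat_expect_def N_def g_def block_mat_def diag_mat_def RS nc_stateD[OF \<phi>]
        nc_state_zero[OF \<phi>] split: sum.splits)
  with G have G': "mat_cauchy_transform \<phi> (mat_hat M x) J = diag_mat g" by simp
  have yy: "y k * adj (y k) = complex_of_real ((cmod (D $ k))\<^sup>2) *\<^sub>C (x * adj x)"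
    "adj (y k) * y k = complex_of_real ((cmod (D $ k))\<^sup>2) *\<^sub>C (adj x * x)" for k
    unfolding y_def adj_scaleC mult_scaleC_left mult_scaleC_right scaleC_scaleC
    by (simp_all add: complex_norm_square mult.commute del: of_real_power)
  have powi: "complex_of_real (cmod c powi (-2)) = 1 / complex_of_real ((cmod c)\<^sup>2)" for c
    by (simp add: power_int_minus divide_inverse)
  have val: "q k * \<phi> (R k) = q k * complex_of_real (cmod (D $ k) powi (-2)) *
      cauchy_transform \<phi> (x * adj x) (p k * q k * complex_of_real (cmod (D $ k) powi (-2)))"
    "p k * \<phi> (S k) = p k * complex_of_real (cmod (D $ k) powi (-2)) *
      cauchy_transform \<phi> (adj x * x) (p k * q k * complex_of_real (cmod (D $ k) powi (-2)))"
    if "D $ k \<noteq> 0" for k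
    using alg_inv_scaleC[OF RS(1,2)[of k, unfolded yy]] alg_inv_scaleC[OF RS(3,4)[of k, unfolded yy]] that
    unfolding cauchy_transform_def powi by (simp_all add: nc_stateD[OF \<phi>])
  \<comment> \<open>For the lower entries the block is \<open>inv \<pi> k\<close>, whose
    \<open>q\<close> is \<open>J2 $ k\<close>.\<close>
  show ?thesis
    using G' val(1) val(2)[of "inv \<pi> k" for k]
    by (intro exI[of _ g] conjI allI impI) (simp_all only: g_def p_def q_def vec_lambda_beta sum.case inv)
qed

end
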